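(* Let $B$ be a commutative ring. (a) For any pair $p,q\in B[y]$ the $B$-homomorphism $$\phi:B[y]/(y-q(p(y)))\longrightarrow B[y]/(y-p(q(y))),\qquad y\longmapsto q(y),$$ is an isomorphism. (b) In particular, for any $a\in B$ and $p\in B[y]$ the $B$-homomorphism $$\phi:B[y]/(y+ap(y))\longrightarrow B[y]/(y+p(ay)),\qquad y\longmapsto ay,$$ is an isomorphism. Moreover, if $a^k\mid p(0)$ then also $$\phi_k:B[y]/(y+ap(y))\longrightarrow B[y]\Big/\Bigl(y+\frac{p(a^{k+1}y)}{a^k}\Bigr),\qquad y\longmapsto a^{k+1}y,$$ is an isomorphism.
   Context: If $p=\sum_ip_iy^i$ and $p(0)=a^kc$, then $p(a^{k+1}y)/a^k$ denotes $c+\sum_{i\ge1}p_ia^{(k+1)i-k}y^i$. *)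

theory Defs
  imports "HOL-Algebra.UnivPoly" "HOL-Algebra.QuotRing"
begin

definition poly_var :: "('a, 'm) ring_scheme \<Rightarrow> nat \<Rightarrow> 'a" where
  "poly_var B = monom (UP B) \<one>\<^bsub>B\<^esub> 1"

definition poly_const :: "('a, 'm) ring_scheme \<Rightarrow> 'a \<Rightarrow> nat \<Rightarrow> 'a" where
  "poly_const B b = monom (UP B) b 0"

text \<open>\<open>poly_subst B p q\<close> is the polynomial \<open>p(q(y))\<close>.\<close>

definition poly_subst ::
    "('a, 'm) ring_scheme \<Rightarrow> (nat \<Rightarrow> 'a) \<Rightarrow> (nat \<Rightarrow> 'a) \<Rightarrow> nat \<Rightarrow> 'a" where
  "poly_subst B p q = eval B (UP B) (poly_const B) q p"

text \<open>For \<open>p(0) = a\<^sup>k c\<close>, the polynomial denoted \<open>p(a\<^bsup>k+1\<^esup>y)/a\<^sup>k\<close>. The quotient \<open>c\<close> is an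
  argument because it need not be determined by \<open>p\<close>, \<open>a\<close> and \<open>k\<close> when \<open>a\<close> is a zero divisor. The
  natural-number subtraction in the exponent does not truncate, since \<open>i \<ge> 1\<close>.\<close>

definition scaled_poly ::
    "('a, 'm) ring_scheme \<Rightarrow> 'a \<Rightarrow> nat \<Rightarrow> 'a \<Rightarrow> (nat \<Rightarrow> 'a) \<Rightarrow> nat \<Rightarrow> 'a" where
  "scaled_poly B a k c p =
     poly_const B c \<oplus>\<^bsub>UP B\<^esub>
     (\<Oplus>\<^bsub>UP B\<^esub>i\<in>{1..deg B p}.
        monom (UP B) (coeff (UP B) p i \<otimes>\<^bsub>B\<^esub> a [^]\<^bsub>B\<^esub> ((k + 1) * i - k)) i)"

definition quot_poly :: "('a, 'm) ring_scheme \<Rightarrow> (nat \<Rightarrow> 'a) \<Rightarrow> (nat \<Rightarrow> 'a) set ring" where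
  "quot_poly B f = UP B Quot (PIdl\<^bsub>UP B\<^esub> f)"

definition quot_class ::
    "('a, 'm) ring_scheme \<Rightarrow> (nat \<Rightarrow> 'a) \<Rightarrow> (nat \<Rightarrow> 'a) \<Rightarrow> (nat \<Rightarrow> 'a) set" where
  "quot_class B f u = PIdl\<^bsub>UP B\<^esub> f +>\<^bsub>UP B\<^esub> u"

definition quot_alg_hom ::
    "('a, 'm) ring_scheme \<Rightarrow> (nat \<Rightarrow> 'a) \<Rightarrow> (nat \<Rightarrow> 'a) \<Rightarrow>
      ((nat \<Rightarrow> 'a) set \<Rightarrow> (nat \<Rightarrow> 'a) set) set" where
  "quot_alg_hom B f g =
     {\<phi> \<in> ring_hom (quot_poly B f) (quot_poly B g).
        \<forall>b\<in>carrier B. \<phi> (quot_class B f (poly_const B b)) = quot_class B g (poly_const B b)}"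

text \<open>The \<open>B\<close>-homomorphism \<open>B[y]/(f) \<longrightarrow> B[y]/(g)\<close>, \<open>y \<mapsto> s(y)\<close>, is well defined and is an
  isomorphism. HOL functions take unconstrained values outside the carrier, so the homomorphism is
  unique only on the carrier; the statement is therefore made for every function representing it.\<close>

definition subst_hom_is_iso ::
    "('a, 'm) ring_scheme \<Rightarrow> (nat \<Rightarrow> 'a) \<Rightarrow> (nat \<Rightarrow> 'a) \<Rightarrow> (nat \<Rightarrow> 'a) \<Rightarrow> bool" where
  "subst_hom_is_iso B f g s \<longleftrightarrow>
     (\<exists>\<phi>\<in>quot_alg_hom B f g. \<phi> (quot_class B f (poly_var B)) = quot_class B g s) \<and>
     (\<forall>\<phi>\<in>quot_alg_hom B f g. \<phi> (quot_class B f (poly_var B)) = quot_class B g s \<longrightarrow>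
        \<phi> \<in> ring_iso (quot_poly B f) (quot_poly B g))"

end

theory Submission
  imports Defs
begin

text \<open>
  Everything rests on the observation that substitution is associative and respects congruences.
  In \<open>B[y]/(y - p(q(y)))\<close> we have \<open>y \<equiv> p(q)\<close>. Applying \<open>q\<close> to both sides gives \<open>q \<equiv> q(p(q))\<close>, that is,
  the image \<open>q\<close> of \<open>y\<close> satisfies the relation \<open>y = q(p(y))\<close> of the source, so that \<open>y \<mapsto> q\<close> is well
  defined. By symmetry \<open>y \<mapsto> p\<close> is well defined in the other direction, and the two composites send
  \<open>y\<close> to \<open>p(q) \<equiv> y\<close> and to \<open>q(p) \<equiv> y\<close>. This is (a), proved in \<open>subst_hom_is_iso_comp\<close> from the general
  criterion \<open>subst_hom_is_iso_if_inverse\<close> for two substitutions to be mutually inverse.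

  The first half of (b), \<open>subst_hom_is_iso_smult\<close>, is (a) for the pair \<open>-p\<close> and \<open>ay\<close>. For the second
  half, \<open>subst_hom_is_iso_scaled\<close>, this step is iterated: if \<open>p(0) = a\<^bsup>k+1\<^esup>c\<close>, then every coefficient of
  \<open>p(ay)\<close> is formally divisible by \<open>a\<close>, so \<open>p(ay) = a r(y)\<close> with \<open>r(0) = a\<^sup>kc\<close>. Hence
  \<open>B[y]/(y + ap(y))\<close> is isomorphic to \<open>B[y]/(y + ar(y))\<close> via \<open>y \<mapsto> ay\<close>, and the exponent \<open>k\<close> has dropped
  by one. Starting from \<open>p(0) = a\<^sup>kc\<close>, the composite of the \<open>k + 1\<close> isomorphisms obtained in this way
  sends \<open>y\<close> to \<open>a\<^bsup>k+1\<^esup>y\<close>. Because \<open>a\<close> may be a zero divisor, the divisions by powers of \<open>a\<close> are carried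
  out on exponents; only for the constant term a quotient in \<open>B\<close> occurs, and there it is the given \<open>c\<close>
  times a power of \<open>a\<close>.
\<close>

context UP_cring
begin

section \<open>Substitution of polynomials\<close>

lemma poly_var_eq: "poly_var R = monom P \<one> 1"
  by (simp add: poly_var_def P_def)

lemma poly_const_eq: "poly_const R b = monom P b 0"
  by (simp add: poly_const_def P_def)

lemma poly_var_closed [simp]: "poly_var R \<in> carrier P"
  by (simp add: poly_var_eq)

lemma poly_const_closed [simp]: "b \<in> carrier R \<Longrightarrow> poly_const R b \<in> carrier P"
  by (simp add: poly_const_eq)

lemma smult_eq_const_mult:
  "a \<in> carrier R \<Longrightarrow> p \<in> carrier P \<Longrightarrow> a \<odot>\<^bsub>P\<^esub> p = poly_const R a \<otimes>\<^bsub>P\<^esub> p"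
  by (simp add: poly_const_eq monom_mult_is_smult)

text \<open>
  The uniqueness half of the universal property of \<open>B[y]\<close>, with the structure map \<open>B \<rightarrow> S\<close> read off from
  one of the two homomorphisms. Associativity of substitution and its compatibility with congruences
  are instances: both sides are homomorphisms in the polynomial being substituted into, so constants
  and \<open>y\<close> decide.
\<close>
lemma poly_hom_eqI:
  assumes S: "cring S" and F: "F \<in> ring_hom P S" and G: "G \<in> ring_hom P S"
    and const: "\<And>b. b \<in> carrier R \<Longrightarrow> F (poly_const R b) = G (poly_const R b)"
    and var: "F (poly_var R) = G (poly_var R)"
    and u: "u \<in> carrier P"
  shows "F u = G u"
proof -
  let ?h = "\<lambda>b. G (poly_const R b)"
  have "?h \<in> ring_hom R S"
    using ring_hom_trans[OF const_ring_hom G] by (simp add: o_def poly_const_eq)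
  then interpret UP_pre_univ_prop R S ?h P
    using UP_pre_univ_propI[OF R.cring_axioms S] unfolding P_def by simp
  have "G (poly_var R) \<in> carrier S"
    using ring_hom_closed[OF G] by simp
  then show ?thesis
    using const var u
    by (intro UP_hom_unique[OF ring_homD[OF F] _ _ ring_homD[OF G]]) (auto simp: poly_var_eq poly_const_eq)
qed

lemma poly_subst_hom:
  assumes "s \<in> carrier P"
  shows "(\<lambda>u. poly_subst R u s) \<in> ring_hom P P"
    and "b \<in> carrier R \<Longrightarrow> poly_subst R (poly_const R b) s = poly_const R b"
    and "poly_subst R (poly_var R) s = s"
proof -
  have "poly_const R \<in> ring_hom R P"
    using const_ring_hom by (simp add: poly_const_eq[abs_def])
  then interpret E: UP_pre_univ_prop R P "poly_const R" P
    using UP_pre_univ_propI[OF R.cring_axioms P.cring_axioms] unfolding P_def by simp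
  have eq: "(\<lambda>u. poly_subst R u s) = eval R P (poly_const R) s"
    by (rule ext) (simp add: poly_subst_def P_def)
  show "(\<lambda>u. poly_subst R u s) \<in> ring_hom P P"
    unfolding eq using assms by (rule E.eval_ring_hom)
  show "b \<in> carrier R \<Longrightarrow> poly_subst R (poly_const R b) s = poly_const R b"
    using E.eval_const[OF assms, of b] fun_cong[OF eq] by (simp add: poly_const_eq)
  show "poly_subst R (poly_var R) s = s"
    using E.eval_monom1[OF assms] fun_cong[OF eq] by (simp add: poly_var_eq)
qed

lemma poly_subst_ring_hom_cring:
  "s \<in> carrier P \<Longrightarrow> ring_hom_cring P P (\<lambda>u. poly_subst R u s)"
  using poly_subst_hom(1) by (intro ring_hom_cringI P.cring_axioms)

lemma poly_subst_closed [simp]: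
  "u \<in> carrier P \<Longrightarrow> s \<in> carrier P \<Longrightarrow> poly_subst R u s \<in> carrier P"
  using ring_hom_closed[OF poly_subst_hom(1)] .

lemma poly_subst_smult:
  assumes "s \<in> carrier P" "a \<in> carrier R" "u \<in> carrier P"
  shows "poly_subst R (a \<odot>\<^bsub>P\<^esub> u) s = a \<odot>\<^bsub>P\<^esub> poly_subst R u s"
  using assms ring_hom_mult[OF poly_subst_hom(1)[OF assms(1)], of "poly_const R a" u]
  by (simp add: smult_eq_const_mult poly_subst_hom(2))

lemma poly_subst_var_right:
  assumes "u \<in> carrier P"
  shows "poly_subst R u (poly_var R) = u"
  by (rule poly_hom_eqI[where G = "\<lambda>u. u", OF P.cring_axioms poly_subst_hom(1)])
    (use assms in \<open>auto simp: poly_subst_hom ring_hom_def\<close>)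

lemma poly_subst_assoc:
  assumes "u \<in> carrier P" "s \<in> carrier P" "t \<in> carrier P"
  shows "poly_subst R (poly_subst R u s) t = poly_subst R u (poly_subst R s t)"
  by (rule poly_hom_eqI[where G = "\<lambda>u. poly_subst R u (poly_subst R s t)", OF P.cring_axioms
        ring_hom_trans[OF poly_subst_hom(1) poly_subst_hom(1), unfolded o_def] poly_subst_hom(1)])
    (use assms in \<open>auto simp: poly_subst_hom\<close>)

section \<open>Substitution modulo a polynomial\<close>

lemma
  assumes "f \<in> carrier P"
  shows quot_poly_cring: "cring (quot_poly R f)"
    and quot_class_hom: "quot_class R f \<in> ring_hom P (quot_poly R f)"
    and quot_class_eq_zero_iff:
      "u \<in> carrier P \<Longrightarrow> quot_class R f u = \<zero>\<^bsub>quot_poly R f\<^esub> \<longleftrightarrow> u \<in> PIdl\<^bsub>P\<^esub> f"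
    and quot_poly_carrier: "carrier (quot_poly R f) = quot_class R f ` carrier P"
proof -
  interpret I: ideal "PIdl\<^bsub>P\<^esub> f" P
    using assms by (rule P.cgenideal_ideal)
  show "cring (quot_poly R f)"
    using I.quotient_is_cring[OF P.cring_axioms] by (simp add: quot_poly_def P_def)
  have "quot_class R f = (+>\<^bsub>P\<^esub>) (PIdl\<^bsub>P\<^esub> f)"
    by (rule ext) (simp add: quot_class_def P_def)
  then show "quot_class R f \<in> ring_hom P (quot_poly R f)"
    using I.rcos_ring_hom by (simp add: quot_poly_def P_def)
  show "quot_class R f u = \<zero>\<^bsub>quot_poly R f\<^esub> \<longleftrightarrow> u \<in> PIdl\<^bsub>P\<^esub> f" if "u \<in> carrier P"
    using I.a_rcos_const I.a_rcos_self that
    by (auto simp: quot_poly_def quot_class_def FactRing_def P_def)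
  show "carrier (quot_poly R f) = quot_class R f ` carrier P"
    by (auto simp: quot_poly_def quot_class_def FactRing_def A_RCOSETS_defs a_r_coset_def P_def)
qed

lemma quot_class_ring_hom_cring:
  "f \<in> carrier P \<Longrightarrow> ring_hom_cring P (quot_poly R f) (quot_class R f)"
  by (intro ring_hom_cringI P.cring_axioms quot_poly_cring quot_class_hom)

lemma quot_class_subst_hom:
  assumes "g \<in> carrier P" "s \<in> carrier P"
  shows "(\<lambda>u. quot_class R g (poly_subst R u s)) \<in> ring_hom P (quot_poly R g)"
  using ring_hom_trans[OF poly_subst_hom(1) quot_class_hom] assms by (simp add: o_def)

text \<open>
  Only the class of the substituted polynomial matters, because \<open>u \<mapsto> [u(s)]\<close> is determined by the
  image \<open>[s]\<close> of \<open>y\<close>.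
\<close>
lemma quot_class_subst_cong:
  assumes "g \<in> carrier P" "s \<in> carrier P" "t \<in> carrier P" "u \<in> carrier P"
    and "quot_class R g s = quot_class R g t"
  shows "quot_class R g (poly_subst R u s) = quot_class R g (poly_subst R u t)"
  by (rule poly_hom_eqI[OF quot_poly_cring quot_class_subst_hom quot_class_subst_hom])
    (use assms in \<open>auto simp: poly_subst_hom\<close>)

text \<open>
  A \<open>B\<close>-homomorphism of the quotients has only one possible value on each class, since \<open>B[y]\<close> maps onto
  the source.
\<close>
lemma quot_alg_hom_class:
  assumes f: "f \<in> carrier P" and g: "g \<in> carrier P" and s: "s \<in> carrier P"
    and \<phi>: "\<phi> \<in> quot_alg_hom R f g" "\<phi> (quot_class R f (poly_var R)) = quot_class R g s"
    and u: "u \<in> carrier P"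
  shows "\<phi> (quot_class R f u) = quot_class R g (poly_subst R u s)"
proof (rule poly_hom_eqI[OF quot_poly_cring[OF g] _ quot_class_subst_hom[OF g s] _ _ u])
  have "\<phi> \<in> ring_hom (quot_poly R f) (quot_poly R g)"
    using \<phi> by (simp add: quot_alg_hom_def)
  from ring_hom_trans[OF quot_class_hom[OF f] this]
  show "(\<lambda>u. \<phi> (quot_class R f u)) \<in> ring_hom P (quot_poly R g)"
    by (simp add: o_def)
qed (use \<phi> s in \<open>auto simp: poly_subst_hom quot_alg_hom_def\<close>)

section \<open>Isomorphisms given by substitutions\<close>

text \<open>
  One isomorphism suffices: any other function representing the homomorphism agrees with it on the
  carrier, and being an isomorphism depends on nothing else.
\<close>
lemma subst_hom_is_isoI:
  assumes f: "f \<in> carrier P" and g: "g \<in> carrier P" and s: "s \<in> carrier P"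
    and iso: "\<phi> \<in> ring_iso (quot_poly R f) (quot_poly R g)"
    and \<phi>: "\<And>u. u \<in> carrier P \<Longrightarrow> \<phi> (quot_class R f u) = quot_class R g (poly_subst R u s)"
  shows "subst_hom_is_iso R f g s"
proof -
  have hom: "\<phi> \<in> ring_hom (quot_poly R f) (quot_poly R g)"
    using iso by (simp add: ring_iso_def)
  then have alg: "\<phi> \<in> quot_alg_hom R f g"
    using s by (simp add: quot_alg_hom_def \<phi> poly_subst_hom)
  have var: "\<phi> (quot_class R f (poly_var R)) = quot_class R g s"
    using s by (simp add: \<phi> poly_subst_hom)
  have "\<psi> \<in> ring_iso (quot_poly R f) (quot_poly R g)"
    if \<psi>: "\<psi> \<in> quot_alg_hom R f g" "\<psi> (quot_class R f (poly_var R)) = quot_class R g s" for \<psi>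
  proof -
    have "\<psi> X = \<phi> X" if "X \<in> carrier (quot_poly R f)" for X
      using that quot_alg_hom_class[OF f g s \<psi>] by (auto simp: quot_poly_carrier f \<phi>)
    then have "bij_betw \<psi> (carrier (quot_poly R f)) (carrier (quot_poly R g))"
      using iso by (simp add: ring_iso_def cong: bij_betw_cong)
    then show ?thesis
      using \<psi>(1) by (simp add: ring_iso_def quot_alg_hom_def)
  qed
  with alg var show ?thesis
    unfolding subst_hom_is_iso_def by blast
qed

lemma subst_hom_is_isoE:
  assumes "f \<in> carrier P" "g \<in> carrier P" "s \<in> carrier P" "subst_hom_is_iso R f g s"
  obtains \<phi> where "\<phi> \<in> ring_iso (quot_poly R f) (quot_poly R g)"
    and "\<And>u. u \<in> carrier P \<Longrightarrow> \<phi> (quot_class R f u) = quot_class R g (poly_subst R u s)"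
  using assms quot_alg_hom_class[OF assms(1-3)] unfolding subst_hom_is_iso_def by blast

lemma subst_hom_is_iso_trans:
  assumes P: "f \<in> carrier P" "g \<in> carrier P" "h \<in> carrier P" "s \<in> carrier P" "t \<in> carrier P"
    and fg: "subst_hom_is_iso R f g s" and gh: "subst_hom_is_iso R g h t"
  shows "subst_hom_is_iso R f h (poly_subst R s t)"
proof -
  obtain \<phi> where \<phi>: "\<phi> \<in> ring_iso (quot_poly R f) (quot_poly R g)"
    "\<And>u. u \<in> carrier P \<Longrightarrow> \<phi> (quot_class R f u) = quot_class R g (poly_subst R u s)"
    using subst_hom_is_isoE[OF _ _ _ fg] P by blast
  obtain \<psi> where \<psi>: "\<psi> \<in> ring_iso (quot_poly R g) (quot_poly R h)"
    "\<And>u. u \<in> carrier P \<Longrightarrow> \<psi> (quot_class R g u) = quot_class R h (poly_subst R u t)"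
    using subst_hom_is_isoE[OF _ _ _ gh] P by blast
  show ?thesis
    by (rule subst_hom_is_isoI[OF _ _ _ ring_iso_set_trans[OF \<phi>(1) \<psi>(1)]])
      (use P in \<open>simp_all add: \<phi>(2) \<psi>(2) poly_subst_assoc\<close>)
qed

lemma quot_class_subst_eq_zero:
  assumes "f \<in> carrier P" "g \<in> carrier P" "s \<in> carrier P"
    and fs: "quot_class R g (poly_subst R f s) = \<zero>\<^bsub>quot_poly R g\<^esub>"
    and u: "u \<in> PIdl\<^bsub>P\<^esub> f"
  shows "quot_class R g (poly_subst R u s) = \<zero>\<^bsub>quot_poly R g\<^esub>"
proof -
  interpret Q: cring "quot_poly R g"
    using assms by (intro quot_poly_cring)
  obtain v where v: "v \<in> carrier P" "u = v \<otimes>\<^bsub>P\<^esub> f"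
    using u by (auto simp: cgenideal_def)
  have hom: "(\<lambda>u. quot_class R g (poly_subst R u s)) \<in> ring_hom P (quot_poly R g)"
    using assms by (intro quot_class_subst_hom)
  show ?thesis
    using ring_hom_mult[OF hom v(1) assms(1)] ring_hom_closed[OF hom v(1)] by (simp add: v(2) fs)
qed

text \<open>
  The inverse homomorphism \<open>y \<mapsto> t\<close> of the quotients need not be constructed. It is enough to
  consider \<open>u \<mapsto> [u(s)]\<close> on polynomials. It is surjective because \<open>w(t)\<close> is sent to \<open>[w(t(s))] = [w]\<close>.
  Its kernel contains \<open>f\<close>, and is no larger: if \<open>u(s)\<close> is a multiple of \<open>g\<close>, then
  \<open>u \<equiv> u(s(t)) = u(s)(t)\<close> is a multiple of \<open>g(t) \<equiv> 0\<close> modulo \<open>f\<close>. The first isomorphism theorem then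
  applies.
\<close>
lemma subst_hom_is_iso_if_inverse:
  assumes f: "f \<in> carrier P" and g: "g \<in> carrier P" and s: "s \<in> carrier P" and t: "t \<in> carrier P"
    and fs: "quot_class R g (poly_subst R f s) = \<zero>\<^bsub>quot_poly R g\<^esub>"
    and gt: "quot_class R f (poly_subst R g t) = \<zero>\<^bsub>quot_poly R f\<^esub>"
    and st: "quot_class R f (poly_subst R s t) = quot_class R f (poly_var R)"
    and ts: "quot_class R g (poly_subst R t s) = quot_class R g (poly_var R)"
  shows "subst_hom_is_iso R f g s"
proof -
  define \<psi> where "\<psi> = (\<lambda>u. quot_class R g (poly_subst R u s))"
  interpret G: ring_hom_cring P "quot_poly R g" "quot_class R g"
    using g by (rule quot_class_ring_hom_cring)
  have "\<psi> \<in> ring_hom P (quot_poly R g)"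
    unfolding \<psi>_def using g s by (rule quot_class_subst_hom)
  then interpret \<psi>: ring_hom_ring P "quot_poly R g" \<psi>
    by (intro ring_hom_ringI2 P.ring_axioms G.S.ring_axioms)
  have "quot_class R g w = \<psi> (poly_subst R w t)" if w: "w \<in> carrier P" for w
    using quot_class_subst_cong[OF g _ _ w ts] w s t
    by (simp add: \<psi>_def poly_subst_assoc poly_subst_var_right)
  then have "carrier (quot_poly R g) \<subseteq> \<psi> ` carrier P"
    using t by (simp add: quot_poly_carrier[OF g] image_subset_iff)
  moreover have "\<psi> ` carrier P \<subseteq> carrier (quot_poly R g)"
    by (rule image_subsetI) (rule \<psi>.hom_closed)
  ultimately have surj: "\<psi> ` carrier P = carrier (quot_poly R g)"
    by (rule equalityI[rotated])
  have ker: "a_kernel P (quot_poly R g) \<psi> = PIdl\<^bsub>P\<^esub> f"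
  proof (rule equalityI; rule subsetI)
    fix u assume "u \<in> a_kernel P (quot_poly R g) \<psi>"
    then have u: "u \<in> carrier P" and "\<psi> u = \<zero>\<^bsub>quot_poly R g\<^esub>"
      unfolding a_kernel_def' by simp_all
    then have "poly_subst R u s \<in> PIdl\<^bsub>P\<^esub> g"
      using g s by (simp add: \<psi>_def quot_class_eq_zero_iff)
    then have "quot_class R f (poly_subst R (poly_subst R u s) t) = \<zero>\<^bsub>quot_poly R f\<^esub>"
      by (rule quot_class_subst_eq_zero[OF g f t gt])
    then have "quot_class R f u = \<zero>\<^bsub>quot_poly R f\<^esub>"
      using quot_class_subst_cong[OF f _ _ u st] u s t
      by (simp add: poly_subst_assoc poly_subst_var_right)
    then show "u \<in> PIdl\<^bsub>P\<^esub> f"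
      using f u by (simp add: quot_class_eq_zero_iff)
  next
    fix u assume u: "u \<in> PIdl\<^bsub>P\<^esub> f"
    then have "u \<in> carrier P"
      by (rule ideal.Icarr[OF P.cgenideal_ideal[OF f]])
    then show "u \<in> a_kernel P (quot_poly R g) \<psi>"
      unfolding a_kernel_def' using quot_class_subst_eq_zero[OF f g s fs u] by (simp add: \<psi>_def)
  qed
  have quot: "P Quot a_kernel P (quot_poly R g) \<psi> = quot_poly R f"
    unfolding ker by (simp add: quot_poly_def P_def)
  have "(\<lambda>X. the_elem (\<psi> ` X)) \<in> ring_iso (quot_poly R f) (quot_poly R g)"
    using \<psi>.FactRing_iso_set_aux unfolding quot surj by simp
  moreover have "the_elem (\<psi> ` quot_class R f u) = quot_class R g (poly_subst R u s)"
    if "u \<in> carrier P" for u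
    using \<psi>.the_elem_simp[OF that] unfolding ker by (simp add: quot_class_def \<psi>_def P_def)
  ultimately show ?thesis
    by (rule subst_hom_is_isoI[OF f g s])
qed

section \<open>The two compositions of a pair of polynomials\<close>

text \<open>This turns the relation \<open>y - p(q)\<close> into the congruence \<open>y \<equiv> p(q)\<close>.\<close>
lemma quot_class_minus_self:
  assumes "s \<in> carrier P" "t \<in> carrier P"
  shows "quot_class R (s \<ominus>\<^bsub>P\<^esub> t) s = quot_class R (s \<ominus>\<^bsub>P\<^esub> t) t"
proof -
  define f where "f = s \<ominus>\<^bsub>P\<^esub> t"
  have f: "f \<in> carrier P"
    using assms by (simp add: f_def)
  interpret F: ring_hom_cring P "quot_poly R f" "quot_class R f"
    using f by (rule quot_class_ring_hom_cring)
  have "quot_class R f (s \<ominus>\<^bsub>P\<^esub> t) = \<zero>\<^bsub>quot_poly R f\<^esub>"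
    using f P.cgenideal_self[OF f] by (simp add: quot_class_eq_zero_iff flip: f_def)
  then have "quot_class R f s \<ominus>\<^bsub>quot_poly R f\<^esub> quot_class R f t = \<zero>\<^bsub>quot_poly R f\<^esub>"
    using assms by (simp add: a_minus_def)
  then have "quot_class R f s = quot_class R f t"
    using assms F.S.minus_equality[of "quot_class R f s" "\<ominus>\<^bsub>quot_poly R f\<^esub> quot_class R f t"]
    by (simp add: a_minus_def)
  then show ?thesis
    by (simp only: f_def)
qed

text \<open>
  Modulo \<open>g = y - p(q)\<close>, the polynomial \<open>q\<close> is a fixed point of \<open>q(p(\<dots>))\<close>: apply \<open>q\<close> to the
  congruence \<open>y \<equiv> p(q)\<close>.
\<close>
lemma quot_class_subst_fixed_point:
  assumes p: "p \<in> carrier P" and q: "q \<in> carrier P"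
  defines "g \<equiv> poly_var R \<ominus>\<^bsub>P\<^esub> poly_subst R p q"
  shows "quot_class R g (poly_subst R (poly_var R \<ominus>\<^bsub>P\<^esub> poly_subst R q p) q) = \<zero>\<^bsub>quot_poly R g\<^esub>"
proof -
  have g: "g \<in> carrier P"
    using p q by (simp add: g_def)
  interpret G: ring_hom_cring P "quot_poly R g" "quot_class R g"
    using g by (rule quot_class_ring_hom_cring)
  interpret Q: ring_hom_cring P P "\<lambda>u. poly_subst R u q"
    using q by (rule poly_subst_ring_hom_cring)
  have "quot_class R g (poly_var R) = quot_class R g (poly_subst R p q)"
    unfolding g_def using p q by (intro quot_class_minus_self) simp_all
  from quot_class_subst_cong[OF g _ _ q this]
  have "quot_class R g (poly_subst R q (poly_subst R p q)) = quot_class R g q"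
    using p q by (simp add: poly_subst_var_right)
  then show ?thesis
    using p q by (simp add: a_minus_def poly_subst_hom poly_subst_assoc G.S.r_neg)
qed

lemma subst_hom_is_iso_comp:
  assumes p: "p \<in> carrier P" and q: "q \<in> carrier P"
  shows "subst_hom_is_iso R (poly_var R \<ominus>\<^bsub>P\<^esub> poly_subst R q p)
    (poly_var R \<ominus>\<^bsub>P\<^esub> poly_subst R p q) q"
  by (rule subst_hom_is_iso_if_inverse[where t = p])
    (use p q in \<open>simp_all add: quot_class_subst_fixed_point quot_class_minus_self[symmetric]\<close>)

text \<open>The pair \<open>-p\<close> and \<open>q = ay\<close> has the compositions \<open>q(-p) = -ap\<close> and \<open>(-p)(q) = -p(ay)\<close>.\<close>
corollary subst_hom_is_iso_smult:
  assumes a: "a \<in> carrier R" and p: "p \<in> carrier P"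
  shows "subst_hom_is_iso R (poly_var R \<oplus>\<^bsub>P\<^esub> a \<odot>\<^bsub>P\<^esub> p)
    (poly_var R \<oplus>\<^bsub>P\<^esub> poly_subst R p (a \<odot>\<^bsub>P\<^esub> poly_var R)) (a \<odot>\<^bsub>P\<^esub> poly_var R)"
proof -
  let ?q = "a \<odot>\<^bsub>P\<^esub> poly_var R"
  have q: "?q \<in> carrier P"
    using a by simp
  interpret Q: ring_hom_cring P P "\<lambda>u. poly_subst R u ?q"
    using q by (rule poly_subst_ring_hom_cring)
  have "poly_subst R ?q (\<ominus>\<^bsub>P\<^esub> p) = \<ominus>\<^bsub>P\<^esub> (a \<odot>\<^bsub>P\<^esub> p)"
    using a p by (simp add: poly_subst_smult poly_subst_hom) (simp add: smult_eq_const_mult P.r_minus)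
  with subst_hom_is_iso_comp[OF _ q, of "\<ominus>\<^bsub>P\<^esub> p"] a p show ?thesis
    by (simp add: a_minus_def)
qed

section \<open>Dividing the rescaled polynomial by a power of the scalar\<close>

text \<open>
  The common shape of the polynomials \<open>p(a\<^bsup>k+1\<^esup>y)/a\<^sup>k\<close> and of the intermediate quotient \<open>p(ay)/a\<close>: the
  constant term is prescribed and the other coefficients of \<open>p\<close> are multiplied by weights \<open>b i\<close>.
\<close>
lemma
  assumes c: "c \<in> carrier R" and p: "p \<in> carrier P" and b: "\<And>i. b i \<in> carrier R"
  defines "r \<equiv> poly_const R c \<oplus>\<^bsub>P\<^esub> (\<Oplus>\<^bsub>P\<^esub>i\<in>{1..deg R p}. monom P (coeff P p i \<otimes> b i) i)"
  shows reweighted_poly_closed: "r \<in> carrier P"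
    and coeff_reweighted_poly: "coeff P r n = (if n = 0 then c else coeff P p n \<otimes> b n)"
proof -
  let ?t = "\<lambda>i. monom P (coeff P p i \<otimes> b i) i"
  have t: "?t \<in> {1..deg R p} \<rightarrow> carrier P"
    using p b by simp
  then show "r \<in> carrier P"
    using c by (simp add: r_def)
  have "coeff P (\<Oplus>\<^bsub>P\<^esub>i\<in>{1..deg R p}. ?t i) n
      = (\<Oplus>i\<in>{1..deg R p}. if n = i then coeff P p i \<otimes> b i else \<zero>)"
    unfolding coeff_finsum[OF finite_atLeastAtMost t]
    using p b by (intro R.finsum_cong') auto
  also have "\<dots> = (if n = 0 then \<zero> else coeff P p n \<otimes> b n)"
  proof (cases "n \<in> {1..deg R p}")
    case True
    then show ?thesis
      using p b R.finsum_singleton[of n "{1..deg R p}" "\<lambda>i. coeff P p i \<otimes> b i"] by simp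
  next
    case False
    then have "n = 0 \<or> coeff P p n = \<zero>"
      using deg_aboveD[OF _ p, of n] by auto
    moreover have "(\<Oplus>i\<in>{1..deg R p}. if n = i then coeff P p i \<otimes> b i else \<zero>) = (\<Oplus>i\<in>{1..deg R p}. \<zero>)"
      using False by (intro R.finsum_cong') auto
    ultimately show ?thesis
      using b by auto
  qed
  finally show "coeff P r n = (if n = 0 then c else coeff P p n \<otimes> b n)"
    using c p b t by (simp add: r_def poly_const_eq)
qed

lemma
  assumes "a \<in> carrier R" "c \<in> carrier R" "p \<in> carrier P"
  shows scaled_poly_closed: "scaled_poly R a k c p \<in> carrier P"
    and coeff_scaled_poly: "coeff P (scaled_poly R a k c p) n =
      (if n = 0 then c else coeff P p n \<otimes> a [^] ((k + 1) * n - k))"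
  using reweighted_poly_closed[OF assms(2,3), of "\<lambda>i. a [^] ((k + 1) * i - k)"]
    coeff_reweighted_poly[OF assms(2,3), of "\<lambda>i. a [^] ((k + 1) * i - k)" n] assms(1)
  by (simp_all add: scaled_poly_def P_def)

lemma coeff_subst_scaled_var:
  assumes a: "a \<in> carrier R" and p: "p \<in> carrier P"
  shows "coeff P (poly_subst R p (a \<odot>\<^bsub>P\<^esub> poly_var R)) n = coeff P p n \<otimes> a [^] n"
proof -
  have var: "a \<odot>\<^bsub>P\<^esub> poly_var R = monom P a 1"
    using a by (simp add: poly_var_eq monom_mult_smult[symmetric])
  have "poly_subst R p (a \<odot>\<^bsub>P\<^esub> poly_var R)
      = (\<Oplus>\<^bsub>P\<^esub>i\<in>{..deg R p}. poly_const R (coeff P p i) \<otimes>\<^bsub>P\<^esub> monom P a 1 [^]\<^bsub>P\<^esub> i)"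
    using p unfolding var poly_subst_def P_def[symmetric] by (rule eval_on_carrier)
  also have "\<dots> = (\<Oplus>\<^bsub>P\<^esub>i\<in>{..deg R p}. monom P (coeff P p i \<otimes> a [^] i) i)"
    using a p by (intro P.finsum_cong') (auto simp: monom_pow poly_const_eq monom_mult[symmetric] simp del: monom_mult)
  finally have "coeff P (poly_subst R p (a \<odot>\<^bsub>P\<^esub> poly_var R)) n
      = (\<Oplus>i\<in>{..deg R p}. coeff P (monom P (coeff P p i \<otimes> a [^] i) i) n)"
    using a p by (simp add: coeff_finsum)
  also have "\<dots> = (\<Oplus>i\<in>{..deg R p}. if n = i then coeff P p i \<otimes> a [^] i else \<zero>)"
    using a p by (intro R.finsum_cong') auto
  also have "\<dots> = coeff P p n \<otimes> a [^] n"
  proof (cases "n \<le> deg R p")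
    case True
    then show ?thesis
      using a p R.finsum_singleton[of n "{..deg R p}" "\<lambda>i. coeff P p i \<otimes> a [^] i"] by simp
  next
    case False
    then have "(\<Oplus>i\<in>{..deg R p}. if n = i then coeff P p i \<otimes> a [^] i else \<zero>) = (\<Oplus>i\<in>{..deg R p}. \<zero>)"
      by (intro R.finsum_cong') auto
    with False show ?thesis
      using a p by (simp add: deg_aboveD)
  qed
  finally show ?thesis .
qed

text \<open>
  Induction on \<open>k\<close>, with \<open>p\<close> arbitrary because the step passes from \<open>p\<close> to \<open>r = p(ay)/a\<close>. Rescaling is
  compatible with this: \<open>r(a\<^bsup>k+1\<^esup>y)/a\<^sup>k = p(a\<^bsup>k+2\<^esup>y)/a\<^bsup>k+1\<^esup>\<close>, since in degree \<open>i \<ge> 1\<close> the exponents of \<open>a\<close>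
  satisfy \<open>(i - 1) + ((k + 1)i - k) = (k + 2)i - (k + 1)\<close>.
\<close>
lemma subst_hom_is_iso_scaled:
  assumes a: "a \<in> carrier R" and p: "p \<in> carrier P" and c: "c \<in> carrier R"
    and p0: "coeff P p 0 = a [^] k \<otimes> c"
  shows "subst_hom_is_iso R (poly_var R \<oplus>\<^bsub>P\<^esub> a \<odot>\<^bsub>P\<^esub> p)
    (poly_var R \<oplus>\<^bsub>P\<^esub> scaled_poly R a k c p) (a [^] (k + 1) \<odot>\<^bsub>P\<^esub> poly_var R)"
  using p p0
proof (induction k arbitrary: p)
  case 0
  have "scaled_poly R a 0 c p = poly_subst R p (a \<odot>\<^bsub>P\<^esub> poly_var R)"
    by (rule up_eqI)
      (use 0 a c in \<open>simp_all add: scaled_poly_closed coeff_scaled_poly coeff_subst_scaled_var\<close>)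
  then show ?case
    using subst_hom_is_iso_smult[OF a] 0 a by simp
next
  case (Suc k)
  let ?ay = "a \<odot>\<^bsub>P\<^esub> poly_var R"
  \<comment> \<open>The polynomial \<open>p(ay)/a\<close>, where \<open>a\<^sup>kc\<close> is taken as the quotient of \<open>p(0) = a\<^bsup>k+1\<^esup>c\<close> by \<open>a\<close>.\<close>
  define r where "r = poly_const R (a [^] k \<otimes> c) \<oplus>\<^bsub>P\<^esub>
    (\<Oplus>\<^bsub>P\<^esub>i\<in>{1..deg R p}. monom P (coeff P p i \<otimes> a [^] (i - 1)) i)"
  have r: "r \<in> carrier P"
    and coeff_r: "coeff P r n = (if n = 0 then a [^] k \<otimes> c else coeff P p n \<otimes> a [^] (n - 1))" for n
    unfolding r_def
    using a c Suc.prems reweighted_poly_closed[of "a [^] k \<otimes> c" p "\<lambda>i. a [^] (i - 1)"]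
      coeff_reweighted_poly[of "a [^] k \<otimes> c" p "\<lambda>i. a [^] (i - 1)" n] by simp_all
  have "poly_subst R p ?ay = a \<odot>\<^bsub>P\<^esub> r"
  proof (rule up_eqI)
    fix n
    show "coeff P (poly_subst R p ?ay) n = coeff P (a \<odot>\<^bsub>P\<^esub> r) n"
      using a c r Suc.prems
      by (cases n) (simp_all add: coeff_subst_scaled_var coeff_r R.m_ac)
  qed (use a r Suc.prems in simp_all)
  then have 1: "subst_hom_is_iso R (poly_var R \<oplus>\<^bsub>P\<^esub> a \<odot>\<^bsub>P\<^esub> p) (poly_var R \<oplus>\<^bsub>P\<^esub> a \<odot>\<^bsub>P\<^esub> r) ?ay"
    using subst_hom_is_iso_smult[OF a Suc.prems(1)] by simp
  have "scaled_poly R a k c r = scaled_poly R a (Suc k) c p"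
  proof (rule up_eqI)
    fix n
    show "coeff P (scaled_poly R a k c r) n = coeff P (scaled_poly R a (Suc k) c p) n"
    proof (cases n)
      case 0
      then show ?thesis
        using a c r Suc.prems by (simp add: coeff_scaled_poly)
    next
      case (Suc m)
      have "a [^] m \<otimes> a [^] ((k + 1) * n - k) = a [^] ((Suc k + 1) * n - Suc k)"
        unfolding R.nat_pow_mult[OF a] by (rule arg_cong[where f = "\<lambda>i. a [^] i"]) (simp add: Suc)
      then show ?thesis
        using a c r Suc.prems Suc by (simp add: coeff_scaled_poly coeff_r R.m_assoc)
    qed
  qed (use a c r Suc.prems in \<open>simp_all add: scaled_poly_closed\<close>)
  then have 2: "subst_hom_is_iso R (poly_var R \<oplus>\<^bsub>P\<^esub> a \<odot>\<^bsub>P\<^esub> r)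
      (poly_var R \<oplus>\<^bsub>P\<^esub> scaled_poly R a (Suc k) c p) (a [^] (k + 1) \<odot>\<^bsub>P\<^esub> poly_var R)"
    using Suc.IH[OF r] coeff_r[of 0] by simp
  have "poly_subst R ?ay (a [^] (k + 1) \<odot>\<^bsub>P\<^esub> poly_var R) = a [^] (Suc k + 1) \<odot>\<^bsub>P\<^esub> poly_var R"
    using a by (simp add: poly_subst_smult poly_subst_hom UP_smult_assoc1[symmetric] R.m_comm)
  with subst_hom_is_iso_trans[OF _ _ _ _ _ 1 2] a c r Suc.prems show ?case
    by (simp add: scaled_poly_closed)
qed

end

theorem corollary1p32:
  fixes B :: "('a, 'm) ring_scheme"
  assumes "cring B"
  shows
    "(\<forall>p\<in>carrier (UP B). \<forall>q\<in>carrier (UP B).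
        subst_hom_is_iso B
          (poly_var B \<ominus>\<^bsub>UP B\<^esub> poly_subst B q p)
          (poly_var B \<ominus>\<^bsub>UP B\<^esub> poly_subst B p q)
          q) \<and>
     (\<forall>a\<in>carrier B. \<forall>p\<in>carrier (UP B).
        subst_hom_is_iso B
          (poly_var B \<oplus>\<^bsub>UP B\<^esub> a \<odot>\<^bsub>UP B\<^esub> p)
          (poly_var B \<oplus>\<^bsub>UP B\<^esub> poly_subst B p (a \<odot>\<^bsub>UP B\<^esub> poly_var B))
          (a \<odot>\<^bsub>UP B\<^esub> poly_var B) \<and>
        (\<forall>(k::nat). \<forall>c\<in>carrier B.
           coeff (UP B) p 0 = a [^]\<^bsub>B\<^esub> k \<otimes>\<^bsub>B\<^esub> c \<longrightarrow>
           subst_hom_is_iso B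
             (poly_var B \<oplus>\<^bsub>UP B\<^esub> a \<odot>\<^bsub>UP B\<^esub> p)
             (poly_var B \<oplus>\<^bsub>UP B\<^esub> scaled_poly B a k c p)
             (a [^]\<^bsub>B\<^esub> (k + 1) \<odot>\<^bsub>UP B\<^esub> poly_var B)))"
proof -
  interpret UP_cring B "UP B"
    using assms by (rule UP_cring.intro)
  show ?thesis
    by (intro conjI ballI allI impI subst_hom_is_iso_comp subst_hom_is_iso_smult
        subst_hom_is_iso_scaled)
qed

end
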